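(* Let $n\ge1$. The lattices $L(n,\theta)$ form an increasing sequence with regard to the suborder relation: $$L(n,n)\unlhd\cdots\unlhd L(n,2)\unlhd L(n,1)\unlhd L(n,0)\unlhd\cdots\unlhd L(n,-n+2)$$ (that is, $L(n,\theta)\unlhd L(n,\theta-1)$ for every integer $\theta$ with $-n+3\le\theta\le n$). Moreover, $|L(n,-n+2)|=\binom{2n-1}{n}$.
   Context: A composition of $n$ is a sequence $a=(a_1,\ldots,a_n)$ of nonnegative integers with $\sum a_i=n$ (not necessarily decreasing, zeros allowed). For an integer $\theta$, a transition $T(\theta)$ transforms a composition $a$ into the composition $(a_1,\ldots,a_i-1,a_{i+1}+1,\ldots,a_n)$ for some $1\le i\le n-1$ with $a_i-a_{i+1}\ge\theta$ (and $a_i\ge1$, so that the result is a composition). $L(n,\theta)$ is the set of all compositions obtained from $N=(n,0,\ldots,0)$ by iterating $T(\theta)$, ordered by: $a\ge_\theta b$ iff $b$ is obtained from $a$ by a (possibly empty) finite sequence of transitions $T(\theta)$. For ordered sets, $X\unlhd Y$ means that $X$ is a suborder of $Y$: $X\subseteq Y$ and the order of $X$ is the restriction of the order of $Y$. *)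

theory Defs
  imports Complex_Main "HOL-Algebra.Order"
begin

definition composition :: "nat \<Rightarrow> nat list \<Rightarrow> bool" where
  "composition n a \<longleftrightarrow> length a = n \<and> sum_list a = n"

text \<open>Parts are indexed from 0, so the part written \<open>a_i\<close> in the usual notation is \<open>a ! (i - 1)\<close>.
  The difference of parts is taken in the integers.\<close>

definition transition :: "nat \<Rightarrow> int \<Rightarrow> nat list \<Rightarrow> nat list \<Rightarrow> bool" where
  "transition n \<theta> a b \<longleftrightarrow> composition n a \<and>
     (\<exists>i. Suc i < n \<and> a ! i \<ge> 1 \<and> int (a ! i) - int (a ! Suc i) \<ge> \<theta> \<and>
          b = a[i := a ! i - 1, Suc i := a ! Suc i + 1])"

definition reaches :: "nat \<Rightarrow> int \<Rightarrow> nat list \<Rightarrow> nat list \<Rightarrow> bool" where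
  "reaches n \<theta> = (transition n \<theta>)\<^sup>*\<^sup>*"

definition initial :: "nat \<Rightarrow> nat list" where
  "initial n = n # replicate (n - 1) 0"

text \<open>The order is oriented downwards: the initial composition is the greatest element.\<close>

definition L :: "nat \<Rightarrow> int \<Rightarrow> nat list gorder" where
  "L n \<theta> = \<lparr>carrier = {a. reaches n \<theta> (initial n) a}, eq = (=),
             le = (\<lambda>b a. reaches n \<theta> a b)\<rparr>"

definition suborder :: "'a gorder \<Rightarrow> 'a gorder \<Rightarrow> bool" (infix \<open>\<unlhd>\<close> 50) where
  "X \<unlhd> Y \<longleftrightarrow> carrier X \<subseteq> carrier Y \<and>
     (\<forall>x \<in> carrier X. \<forall>y \<in> carrier X. x \<sqsubseteq>\<^bsub>X\<^esub> y \<longleftrightarrow> x \<sqsubseteq>\<^bsub>Y\<^esub> y)"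

lemma transition_composition:
  assumes "transition n \<theta> a b"
  shows "composition n b"
proof -
  obtain i where i: "Suc i < length a" "a ! i \<ge> 1" "length a = n" "sum_list a = n"
    and b: "b = a[i := a ! i - 1, Suc i := a ! Suc i + 1]"
    using assms unfolding transition_def composition_def by auto
  have "a ! i \<le> sum_list a"
    using i by (intro member_le_sum_list) auto
  then show ?thesis
    using i b unfolding composition_def by (simp add: sum_list_update)
qed

text \<open>Each transition increases the sum of the suffix sums by one, so \<open>L n \<theta>\<close> is partially ordered.\<close>

fun weight :: "nat list \<Rightarrow> nat" where
  "weight [] = 0"
| "weight (x # xs) = sum_list xs + weight xs"

lemma weight_move:
  assumes "Suc i < length a" "a ! i \<ge> 1"
  shows "weight (a[i := a ! i - 1, Suc i := a ! Suc i + 1]) = Suc (weight a)"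
  using assms
proof (induction a arbitrary: i)
  case (Cons x xs)
  show ?case
  proof (cases i)
    case 0
    then show ?thesis using Cons.prems by (cases xs) auto
  next
    case (Suc j)
    have "xs ! j \<le> sum_list xs"
      using Cons.prems Suc by (intro member_le_sum_list) auto
    then show ?thesis using Cons.IH[of j] Cons.prems Suc by (simp add: sum_list_update)
  qed
qed simp

lemma transition_weight: "transition n \<theta> a b \<Longrightarrow> weight b = Suc (weight a)"
  unfolding transition_def composition_def using weight_move by auto

lemma reaches_weight: "reaches n \<theta> a b \<Longrightarrow> a = b \<or> weight a < weight b"
  unfolding reaches_def
  by (induction rule: rtranclp_induct) (auto dest: transition_weight)

lemma reaches_refl: "reaches n \<theta> a a"
  unfolding reaches_def by simp

lemma reaches_trans: "reaches n \<theta> a b \<Longrightarrow> reaches n \<theta> b c \<Longrightarrow> reaches n \<theta> a c"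
  unfolding reaches_def by (rule rtranclp_trans)

lemma reaches_antisym: "reaches n \<theta> a b \<Longrightarrow> reaches n \<theta> b a \<Longrightarrow> a = b"
  using reaches_weight[of n \<theta> a b] reaches_weight[of n \<theta> b a] by auto

lemma partial_order_L: "partial_order (L n \<theta>)"
  by unfold_locales (simp_all add: L_def reaches_refl, (blast intro: reaches_trans reaches_antisym)+)

end

theory Submission
  imports Defs
begin

text \<open>A move at \<open>i\<close> raises exactly one suffix sum. If a composition \<open>a\<close> has suffix sums at least those
  of \<open>b\<close>, with equality at the one a move of \<open>b\<close> would raise, then \<open>a\<close> admits the same move. Hence
  a path from the initial composition to \<open>b\<close> can be replayed from any \<open>a\<close>, skipping the moves that
  \<open>a\<close> has already made, and ends in the composition whose suffix sums are the pointwise maximum.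
  So the order of \<open>L n \<theta>\<close> is the pointwise order of suffix sums, whatever \<open>\<theta>\<close> is.
  For \<open>\<theta> = 2 - n\<close> the threshold condition follows from \<open>a\<^sub>i \<ge> 1\<close>, because \<open>a\<^sub>i + a\<^sub>i\<^sub>+\<^sub>1 \<le> n\<close>, and all compositions are
  reached.\<close>

definition suffix_sum :: "nat list \<Rightarrow> nat \<Rightarrow> nat" where
  "suffix_sum a j = sum_list (drop j a)"

lemma suffix_sum_step:
  assumes "j < length a"
  shows "suffix_sum a j = a ! j + suffix_sum a (Suc j)"
  unfolding suffix_sum_def using Cons_nth_drop_Suc[OF assms] by (metis sum_list.Cons)

text \<open>Entries are differences of consecutive suffix sums. Trailing zeros do not show in suffix
  sums, hence the separate condition on lengths.\<close>

lemma suffix_sum_eqI: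
  assumes "length a = length b" and "\<And>j. suffix_sum a j = suffix_sum b j"
  shows "a = b"
proof (rule nth_equalityI)
  fix j assume "j < length a"
  then show "a ! j = b ! j"
    using assms suffix_sum_step[of j a] suffix_sum_step[of j b] by simp
qed (rule assms)

lemma suffix_sum_move:
  assumes "Suc i < length a" "a ! i \<ge> 1"
  shows "suffix_sum (a[i := a ! i - 1, Suc i := a ! Suc i + 1]) j =
    suffix_sum a j + (if j = Suc i then 1 else 0)"
  using assms
proof (induction a arbitrary: i j)
  case (Cons x xs)
  show ?case
  proof (cases i)
    case 0
    then obtain y ys where "xs = y # ys" using Cons.prems by (cases xs) auto
    then show ?thesis using 0 Cons.prems
      by (auto simp: suffix_sum_def drop_Cons split: nat.split)
  next
    case (Suc k)
    have "suffix_sum (xs[k := xs ! k - 1, Suc k := xs ! Suc k + 1]) l =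
        suffix_sum xs l + (if l = Suc k then 1 else 0)" for l
      using Cons.IH[of k] Cons.prems Suc by simp
    \<comment> \<open>Index 0 says that the total of \<open>xs\<close> is unchanged, which settles
      \<open>j = 0\<close>; index \<open>j - 1\<close> settles the other \<open>j\<close>.\<close>
    from this[of 0] this[of "j - 1"] show ?thesis
      using Suc by (cases j) (auto simp: suffix_sum_def)
  qed
qed simp

lemma transition_suffix_sum_le:
  "transition n \<theta> a b \<Longrightarrow> suffix_sum a j \<le> suffix_sum b j"
  unfolding transition_def composition_def using suffix_sum_move by auto

lemma reaches_suffix_sum_le: "reaches n \<theta> a b \<Longrightarrow> suffix_sum a j \<le> suffix_sum b j"
  unfolding reaches_def
  by (induction rule: rtranclp_induct) (auto dest: transition_suffix_sum_le intro: order_trans)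

lemma reaches_composition: "reaches n \<theta> a b \<Longrightarrow> composition n a \<Longrightarrow> composition n b"
  unfolding reaches_def
  by (induction rule: rtranclp_induct) (auto dest: transition_composition)

lemma reaches_mono:
  assumes "\<theta>' \<le> \<theta>" and "reaches n \<theta> a b"
  shows "reaches n \<theta>' a b"
proof -
  have "transition n \<theta> \<le> transition n \<theta>'"
    using assms(1) unfolding transition_def by (fastforce intro: order_trans)
  then show ?thesis
    using assms(2) rtranclp_mono unfolding reaches_def by blast
qed

lemma reaches_join:
  assumes "reaches n \<theta> c b" and a: "composition n a"
    and le: "\<And>j. suffix_sum c j \<le> suffix_sum a j"
  shows "\<exists>d. reaches n \<theta> a d \<and> (\<forall>j. suffix_sum d j = max (suffix_sum a j) (suffix_sum b j))"
  using assms(1) unfolding reaches_def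
proof (induction rule: rtranclp_induct)
  case base
  have "reaches n \<theta> a a" by (rule reaches_refl)
  then show ?case using le unfolding reaches_def by (auto simp: max_absorb1)
next
  case (step b b')
  then obtain d where d: "reaches n \<theta> a d"
    and max: "\<And>j. suffix_sum d j = max (suffix_sum a j) (suffix_sum b j)"
    unfolding reaches_def by blast
  have comp: "composition n d" using d a by (rule reaches_composition)
  from step.hyps(2) obtain i where i: "Suc i < n" "b ! i \<ge> 1" "int (b ! i) - int (b ! Suc i) \<ge> \<theta>"
    and b': "b' = b[i := b ! i - 1, Suc i := b ! Suc i + 1]" and lb: "length b = n"
    unfolding transition_def composition_def by blast
  have ld: "length d = n" using comp by (simp add: composition_def)
  have sb': "suffix_sum b' j = suffix_sum b j + (if j = Suc i then 1 else 0)" for j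
    unfolding b' using i lb by (intro suffix_sum_move) auto
  show ?case
  \<comment> \<open>If \<open>a\<close> has already made this move, \<open>d\<close> stays as it is;
    otherwise \<open>d\<close> makes the move too.\<close>
  proof (cases "suffix_sum b' (Suc i) \<le> suffix_sum a (Suc i)")
    case True
    then have "\<forall>j. suffix_sum d j = max (suffix_sum a j) (suffix_sum b' j)"
      using max sb' by auto
    then show ?thesis using d unfolding reaches_def by blast
  next
    case False
    then have eq: "suffix_sum d (Suc i) = suffix_sum b (Suc i)"
      using sb' max by auto
    have ge: "suffix_sum b j \<le> suffix_sum d j" for j using max by simp
    \<comment> \<open>Both entries are differences involving the suffix sum at \<open>Suc i\<close>,
      on which \<open>b\<close> and \<open>d\<close> agree; the suffix sums at \<open>i\<close> and
      \<open>Suc (Suc i)\<close> are at least as large for \<open>d\<close>.\<close>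
    have "b ! i \<le> d ! i" "d ! Suc i \<le> b ! Suc i"
      using eq ge[of i] ge[of "Suc (Suc i)"] i lb ld
        suffix_sum_step[of i b] suffix_sum_step[of i d]
        suffix_sum_step[of "Suc i" b] suffix_sum_step[of "Suc i" d] by auto
    then have en: "d ! i \<ge> 1" "int (d ! i) - int (d ! Suc i) \<ge> \<theta>" using i by auto
    define d' where "d' = d[i := d ! i - 1, Suc i := d ! Suc i + 1]"
    have "transition n \<theta> d d'"
      unfolding transition_def d'_def using comp i en by blast
    moreover have "suffix_sum d' j = suffix_sum d j + (if j = Suc i then 1 else 0)" for j
      unfolding d'_def using i ld en by (intro suffix_sum_move) auto
    then have "\<forall>j. suffix_sum d' j = max (suffix_sum a j) (suffix_sum b' j)"
      using False eq max sb' by auto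
    ultimately show ?thesis
      using d unfolding reaches_def by (meson rtranclp.rtrancl_into_rtrancl)
  qed
qed

lemma composition_initial: "n \<ge> 1 \<Longrightarrow> composition n (initial n)"
  by (simp add: composition_def initial_def sum_list_replicate)

text \<open>If the suffix sums of \<open>a\<close> lie below those of \<open>b\<close>, the maximum
  produced by \<open>reaches_join\<close> is \<open>b\<close> itself. The criterion is free of
  \<theta>, so orders for different thresholds can be compared.\<close>

lemma reaches_iff_suffix_sum_le:
  assumes n: "n \<ge> 1" and a: "reaches n \<theta> (initial n) a" and b: "reaches n \<theta> (initial n) b"
  shows "reaches n \<theta> a b \<longleftrightarrow> (\<forall>j. suffix_sum a j \<le> suffix_sum b j)"
proof
  assume le: "\<forall>j. suffix_sum a j \<le> suffix_sum b j"
  have comp: "composition n a" "composition n b"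
    using a b reaches_composition composition_initial[OF n] by blast+
  obtain d where d: "reaches n \<theta> a d"
    and max: "\<And>j. suffix_sum d j = max (suffix_sum a j) (suffix_sum b j)"
    using reaches_join[OF b comp(1) reaches_suffix_sum_le[OF a]] by blast
  have "d = b"
    using reaches_composition[OF d comp(1)] comp(2) le max
    by (intro suffix_sum_eqI) (auto simp: composition_def max_def)
  then show "reaches n \<theta> a b" using d by simp
qed (simp add: reaches_suffix_sum_le)

text \<open>Lowering the threshold only adds moves, so the carrier grows; on the smaller carrier
  both orders are the comparison of suffix sums.\<close>

lemma suborder_L:
  assumes "n \<ge> 1" and "\<theta>' \<le> \<theta>"
  shows "L n \<theta> \<unlhd> L n \<theta>'"
  using assms reaches_mono reaches_iff_suffix_sum_le
  unfolding suborder_def L_def by auto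

lemma composition_adjacent_le:
  assumes "composition n a" and "Suc i < n"
  shows "a ! i + a ! Suc i \<le> n"
proof -
  have "suffix_sum a i \<le> n"
    using assms(1) append_take_drop_id[of i a]
    unfolding composition_def suffix_sum_def by (metis le_add2 sum_list_append)
  then show ?thesis
    using assms suffix_sum_step[of i a] suffix_sum_step[of "Suc i" a]
    by (simp add: composition_def)
qed

text \<open>Undoing a move lowers \<open>weight\<close> by one, and some move can be undone unless
  all entries after the first vanish, which leaves only the initial composition.\<close>

lemma composition_reached:
  assumes "n \<ge> 1" and "composition n b"
  shows "reaches n (- int n + 2) (initial n) b"
  using assms(2)
proof (induction "weight b" arbitrary: b rule: less_induct)
  case less
  have lb: "length b = n" and sb: "sum_list b = n"
    using less.prems by (auto simp: composition_def)
  show ?case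
  proof (cases "\<exists>i. Suc i < n \<and> b ! Suc i \<ge> 1")
    case False
    show ?thesis
    proof (cases b)
      case Nil
      then show ?thesis using lb assms(1) by simp
    next
      case (Cons x xs)
      have "xs = replicate (n - 1) 0"
        using False lb Cons by (intro nth_equalityI) (auto simp: less_Suc_eq_le)
      then have "b = initial n" using Cons sb by (simp add: initial_def sum_list_replicate)
      then show ?thesis by (simp add: reaches_refl)
    qed
  next
    case True
    then obtain i where i: "Suc i < n" "b ! Suc i \<ge> 1" by blast
    define a where "a = b[i := b ! i + 1, Suc i := b ! Suc i - 1]"
    have "b ! Suc i \<le> sum_list b" using i lb by (intro member_le_sum_list) auto
    then have comp: "composition n a"
      using i lb sb by (simp add: composition_def a_def sum_list_update)
    have b: "b = a[i := a ! i - 1, Suc i := a ! Suc i + 1]"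
      using i lb by (intro nth_equalityI) (auto simp: a_def nth_list_update)
    have ai: "a ! i \<ge> 1" using i lb by (simp add: a_def)
    \<comment> \<open>The threshold holds because the difference of the two entries is twice
      \<open>a ! i\<close> minus their sum, hence at least 2 - n.\<close>
    have "transition n (- int n + 2) a b"
      unfolding transition_def using comp i(1) ai b composition_adjacent_le[OF comp i(1)]
      by (intro conjI exI[of _ i]) auto
    then show ?thesis
      using less.hyps[of a] comp transition_weight
      unfolding reaches_def by (metis lessI rtranclp.rtrancl_into_rtrancl)
  qed
qed

lemma carrier_L_all:
  assumes "n \<ge> 1"
  shows "carrier (L n (- int n + 2)) = {a. length a = n \<and> sum_list a = n}"
proof -
  have "carrier (L n (- int n + 2)) = {a. composition n a}"
    using composition_reached[OF assms] reaches_composition composition_initial[OF assms]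
    unfolding L_def by auto
  then show ?thesis by (simp add: composition_def)
qed

theorem theorem8:
  fixes n :: nat
  assumes "n \<ge> 1"
  shows "(\<forall>\<theta>::int. - int n + 3 \<le> \<theta> \<and> \<theta> \<le> int n \<longrightarrow> L n \<theta> \<unlhd> L n (\<theta> - 1)) \<and>
         card (carrier (L n (- int n + 2))) = (2 * n - 1) choose n"
  \<comment> \<open>Stars and bars counts the lists of length n and sum n as n + n - 1 choose
    n.\<close>
  unfolding carrier_L_all[OF assms] card_length_sum_list mult_2
  using suborder_L[OF assms] by simp

end
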